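(* Let $L(\alpha)\in CE(\mu_6)$ with $\alpha=(b_{0,0},b_{0,1},b_{1,1},b_{1,2},b_{1,4})$ and let $\Delta=b_{0,1}^2-4b_{0,0}b_{1,1}$. (1) If $b_{1,1}\neq0$, $b_{1,4}=b_{1,2}=0$, $\Delta\neq0$, then $L(\alpha)\cong L(1,0,1,0,0)$. (2) If $b_{1,1}\neq0$, $b_{1,4}=b_{1,2}=\Delta=0$, then $L(\alpha)\cong L(0,0,1,0,0)$. (3) If $b_{1,1}=0$, $b_{0,1}\neq0$, $b_{1,4}\neq0$, then $L(\alpha)\cong L(0,1,0,0,1)$. (4) If $b_{1,1}=0$, $b_{0,1}\neq0$, $b_{1,4}=0$, $b_{1,2}\neq0$, then $L(\alpha)\cong L(0,1,0,1,0)$. (5) If $b_{1,1}=0$, $b_{0,1}\neq0$, $b_{1,4}=b_{1,2}=0$, then $L(\alpha)\cong L(0,1,0,0,0)$. (6) If $b_{1,1}=b_{0,1}=0$, $b_{0,0}\neq0$, $b_{1,4}\neq0$, then $L(\alpha)\cong L(1,0,0,0,1)$. (7) If $b_{1,1}=b_{0,1}=0$, $b_{0,0}\neq0$, $b_{1,4}=0$, $b_{1,2}\neq0$, then $L(\alpha)\cong L(1,0,0,1,0)$. (8) If $b_{1,1}=b_{0,1}=0$, $b_{0,0}\neq0$, $b_{1,4}=b_{1,2}=0$, then $L(\alpha)\cong L(1,0,0,0,0)$. (9) If $b_{1,1}=b_{0,1}=b_{0,0}=0$, $b_{1,4}\neq0$, then $L(\alpha)\cong L(0,0,0,0,1)$.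 (10) If $b_{1,1}=b_{0,1}=b_{0,0}=b_{1,4}=0$, $b_{1,2}\neq0$, then $L(\alpha)\cong L(0,0,0,1,0)$. (11) If $b_{1,1}=b_{0,1}=b_{0,0}=b_{1,4}=b_{1,2}=0$, then $L(\alpha)\cong L(0,0,0,0,0)$.
   Context: A Leibniz algebra over $\mathbb{C}$ is a complex vector space with a bilinear bracket satisfying $[x,[y,z]]=[[x,y],z]-[[x,z],y]$. $CE(\mu_6)$ (one-dimensional Leibniz central extensions of the 6-dimensional naturally graded filiform Lie algebra $\mu_6$) is the class of the 7-dimensional complex Leibniz algebras $L(\alpha)$, $\alpha=(b_{0,0},b_{0,1},b_{1,1},b_{1,2},b_{1,4})\in\mathbb{C}^5$, with basis $e_0,\dots,e_6$ and brackets $[e_i,e_0]=e_{i+1}$ ($1\le i\le 5$), $[e_0,e_i]=-e_{i+1}$ ($2\le i\le 5$), $[e_0,e_0]=b_{0,0}e_6$, $[e_0,e_1]=-e_2+b_{0,1}e_6$, $[e_1,e_1]=b_{1,1}e_6$, $[e_1,e_2]=-[e_2,e_1]=b_{1,2}e_6$, $[e_1,e_4]=-[e_4,e_1]=b_{1,4}e_6$, $[e_2,e_3]=-[e_3,e_2]=-b_{1,4}e_6$, all other brackets of basis vectors being zero. $\cong$ means isomorphic as Leibniz algebras. *)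

theory Defs
  imports "HOL-Analysis.Analysis"
begin

locale leibniz_algebra = vector_space scale
  for scale :: "complex \<Rightarrow> 'a :: ab_group_add \<Rightarrow> 'a" +
  fixes bracket :: "'a \<Rightarrow> 'a \<Rightarrow> 'a"
  assumes bracket_add_left: "bracket (x + y) z = bracket x z + bracket y z"
    and bracket_add_right: "bracket x (y + z) = bracket x y + bracket x z"
    and bracket_scale_left: "bracket (scale c x) y = scale c (bracket x y)"
    and bracket_scale_right: "bracket x (scale c y) = scale c (bracket x y)"
    and leibniz_identity:
      "bracket x (bracket y z) = bracket (bracket x y) z - bracket (bracket x z) y"

locale leibniz_isomorphism =
  A: leibniz_algebra scale\<^sub>1 bracket\<^sub>1 +
  B: leibniz_algebra scale\<^sub>2 bracket\<^sub>2 +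
  Vector_Spaces.linear scale\<^sub>1 scale\<^sub>2 f
  for scale\<^sub>1 :: "complex \<Rightarrow> 'a :: ab_group_add \<Rightarrow> 'a" and bracket\<^sub>1
    and scale\<^sub>2 :: "complex \<Rightarrow> 'b :: ab_group_add \<Rightarrow> 'b" and bracket\<^sub>2
    and f :: "'a \<Rightarrow> 'b" +
  assumes bij: "bij f"
    and map_bracket: "f (bracket\<^sub>1 x y) = bracket\<^sub>2 (f x) (f y)"

definition leibniz_isomorphic ::
    "(complex \<Rightarrow> 'a :: ab_group_add \<Rightarrow> 'a) \<Rightarrow> ('a \<Rightarrow> 'a \<Rightarrow> 'a) \<Rightarrow>
     (complex \<Rightarrow> 'b :: ab_group_add \<Rightarrow> 'b) \<Rightarrow> ('b \<Rightarrow> 'b \<Rightarrow> 'b) \<Rightarrow> bool" where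
  "leibniz_isomorphic scale\<^sub>1 bracket\<^sub>1 scale\<^sub>2 bracket\<^sub>2 \<longleftrightarrow>
     (\<exists>f. leibniz_isomorphism scale\<^sub>1 bracket\<^sub>1 scale\<^sub>2 bracket\<^sub>2 f)"

text \<open>Two brackets on the coordinate space with its standard scalar multiplication.\<close>

abbreviation leibniz_iso_vec ::
    "(complex ^ 'n \<Rightarrow> complex ^ 'n \<Rightarrow> complex ^ 'n) \<Rightarrow>
     (complex ^ 'm \<Rightarrow> complex ^ 'm \<Rightarrow> complex ^ 'm) \<Rightarrow> bool" (infix "\<cong>\<^sub>L" 50) where
  "A \<cong>\<^sub>L B \<equiv> leibniz_isomorphic (*s) A (*s) B"

text \<open>The index type \<open>7\<close> has the elements \<open>0, \<dots>, 6\<close>, so the standard basis is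
  \<open>e 0, \<dots>, e 6\<close>; arguments above \<open>6\<close> would wrap around and are never used.\<close>

definition e :: "nat \<Rightarrow> complex ^ 7" where
  "e i = axis (of_nat i) 1"

definition L_basis ::
    "complex \<Rightarrow> complex \<Rightarrow> complex \<Rightarrow> complex \<Rightarrow> complex \<Rightarrow> nat \<Rightarrow> nat \<Rightarrow> complex ^ 7" where
  "L_basis b00 b01 b11 b12 b14 i j =
     (if 1 \<le> i \<and> i \<le> 5 \<and> j = 0 then e (i + 1)
      else if i = 0 \<and> 2 \<le> j \<and> j \<le> 5 then - e (j + 1)
      else if (i, j) = (0, 0) then b00 *s e 6
      else if (i, j) = (0, 1) then - e 2 + b01 *s e 6
      else if (i, j) = (1, 1) then b11 *s e 6
      else if (i, j) = (1, 2) then b12 *s e 6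
      else if (i, j) = (2, 1) then - (b12 *s e 6)
      else if (i, j) = (1, 4) then b14 *s e 6
      else if (i, j) = (4, 1) then - (b14 *s e 6)
      else if (i, j) = (2, 3) then - (b14 *s e 6)
      else if (i, j) = (3, 2) then b14 *s e 6
      else 0)"

text \<open>The bracket of \<open>L(b00, b01, b11, b12, b14)\<close>: the bilinear extension of \<open>L_basis\<close>.\<close>

definition L ::
    "complex \<Rightarrow> complex \<Rightarrow> complex \<Rightarrow> complex \<Rightarrow> complex \<Rightarrow>
     complex ^ 7 \<Rightarrow> complex ^ 7 \<Rightarrow> complex ^ 7" where
  "L b00 b01 b11 b12 b14 x y =
     (\<Sum>i<7. \<Sum>j<7. (x $ of_nat i * y $ of_nat j) *s L_basis b00 b01 b11 b12 b14 i j)"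

lemma exhaust_7:
  fixes x :: 7
  shows "x = 0 \<or> x = 1 \<or> x = 2 \<or> x = 3 \<or> x = 4 \<or> x = 5 \<or> x = 6"
proof (induct x)
  case (of_int z)
  then have "z = 0 \<or> z = 1 \<or> z = 2 \<or> z = 3 \<or> z = 4 \<or> z = 5 \<or> z = 6"
    by simp arith
  then show ?case by auto
qed

lemma forall_7:
  "(\<forall>i::7. P i) \<longleftrightarrow> P 0 \<and> P 1 \<and> P 2 \<and> P 3 \<and> P 4 \<and> P 5 \<and> P 6"
  by (metis exhaust_7)

lemma sum_lessThan_7: "(\<Sum>i<7. g i) = g 0 + g 1 + g 2 + g 3 + g 4 + g 5 + g (6::nat)"
  for g :: "nat \<Rightarrow> 'a :: comm_monoid_add"
proof -
  have "{..<7} = {0, 1, 2, 3, 4, 5, 6::nat}" by auto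
  then show ?thesis by (simp add: ac_simps)
qed

lemma L_component:
  "L b00 b01 b11 b12 b14 x y $ 0 = 0"
  "L b00 b01 b11 b12 b14 x y $ 1 = 0"
  "L b00 b01 b11 b12 b14 x y $ 2 = x $ 1 * y $ 0 - x $ 0 * y $ 1"
  "L b00 b01 b11 b12 b14 x y $ 3 = x $ 2 * y $ 0 - x $ 0 * y $ 2"
  "L b00 b01 b11 b12 b14 x y $ 4 = x $ 3 * y $ 0 - x $ 0 * y $ 3"
  "L b00 b01 b11 b12 b14 x y $ 5 = x $ 4 * y $ 0 - x $ 0 * y $ 4"
  "L b00 b01 b11 b12 b14 x y $ 6 = x $ 5 * y $ 0 - x $ 0 * y $ 5
     + b00 * x $ 0 * y $ 0 + b01 * x $ 0 * y $ 1 + b11 * x $ 1 * y $ 1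
     + b12 * (x $ 1 * y $ 2 - x $ 2 * y $ 1)
     + b14 * (x $ 1 * y $ 4 - x $ 4 * y $ 1 - x $ 2 * y $ 3 + x $ 3 * y $ 2)"
  by (simp_all add: L_def sum_lessThan_7 L_basis_def e_def axis_def algebra_simps)

lemma L_e:
  assumes "i < 7" "j < 7"
  shows "L b00 b01 b11 b12 b14 (e i) (e j) = L_basis b00 b01 b11 b12 b14 i j"
proof -
  have *: "(e k $ of_nat l :: complex) = (if l = k then 1 else 0)" if "k < 7" "l < 7" for k l
  proof -
    have "l \<in> {0, 1, 2, 3, 4, 5, 6}" "k \<in> {0, 1, 2, 3, 4, 5, 6}"
      using that by auto
    then show ?thesis by (auto simp: e_def axis_def)
  qed
  have "L b00 b01 b11 b12 b14 (e i) (e j) =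
      (\<Sum>k<7. \<Sum>l<7. if k = i then if l = j then L_basis b00 b01 b11 b12 b14 k l else 0 else 0)"
    unfolding L_def using assms by (intro sum.cong refl) (auto simp: *)
  also have "\<dots> = (\<Sum>k<7. if k = i then L_basis b00 b01 b11 b12 b14 k j else 0)"
    using assms by (intro sum.cong refl) (simp add: sum.delta)
  finally show ?thesis using assms by (simp add: sum.delta)
qed

lemma leibniz_algebra_L: "leibniz_algebra (*s) (L b00 b01 b11 b12 b14)"
  by unfold_locales
    (simp_all add: vec_eq_iff forall_7 L_component algebra_simps)

end

theory Submission
  imports Defs
begin

text \<open>Each normal form is reached by a change of basis \<open>e\<^sub>0' = A e\<^sub>0 + B e\<^sub>1\<close>,
  \<open>e\<^sub>1' = D e\<^sub>1 + P e\<^sub>3\<close>, \<open>e\<^sub>i\<^sub>+\<^sub>1' = [e\<^sub>i', e\<^sub>0']\<close>.  The brackets of the new basis have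
  the same shape.  Up to the factor \<open>D A\<^sup>5\<close> (from \<open>e\<^sub>6' = D A\<^sup>5 e\<^sub>6\<close>), the triple
  \<open>(b00, b01, b11)\<close> transforms as the binary quadratic form
  \<open>b00 u\<^sup>2 + b01 u v + b11 v\<^sup>2\<close> with discriminant \<open>\<Delta>\<close>; moreover
  \<open>b14' = D b14 / A\<^sup>2\<close> and \<open>b12' = (D b12 + 2 P b14) / A\<^sup>4\<close>.  The parameter \<open>B\<close>
  completes the square, \<open>P\<close> removes \<open>b12\<close> when \<open>b14\<close> is nonzero, and the remaining
  coefficients are normalised by \<open>D\<close> and a complex root \<open>A\<close>.\<close>

text \<open>\<open>basis_change\<close> maps the normal form onto the given algebra, opposite to the
  direction claimed.\<close>

lemma leibniz_isomorphic_sym: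
  assumes "leibniz_isomorphic s1 br1 s2 br2"
  shows "leibniz_isomorphic s2 br2 s1 br1"
proof -
  obtain f where "leibniz_isomorphism s1 br1 s2 br2 f"
    using assms by (auto simp: leibniz_isomorphic_def)
  then interpret f: leibniz_isomorphism s1 br1 s2 br2 f .
  have f_inv: "f (inv f y) = y" for y
    using f.bij by (simp add: bij_is_surj surj_f_inv_f)
  have inv_eqI: "inv f y = x" if "f x = y" for x y
    using that f.bij by (auto simp: bij_is_inj)
  have "leibniz_isomorphism s2 br2 s1 br1 (inv f)"
    by unfold_locales
      (auto intro!: inv_eqI simp: f.add f.scale f.map_bracket f_inv bij_imp_bij_inv[OF f.bij])
  then show ?thesis
    by (auto simp: leibniz_isomorphic_def)
qed

text \<open>The linear map \<open>e\<^sub>i \<mapsto> e\<^sub>i'\<close>, an isomorphism from the algebra with the new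
  parameters onto the one with the old parameters.\<close>

definition basis_change ::
    "complex \<Rightarrow> complex \<Rightarrow> complex \<Rightarrow> complex \<Rightarrow> complex \<Rightarrow> complex \<Rightarrow> complex \<Rightarrow>
     complex ^ 7 \<Rightarrow> complex ^ 7" where
  "basis_change b11 b12 b14 A B D P x = (\<chi> i.
     if i = 0 then A * x $ 0
     else if i = 1 then B * x $ 0 + D * x $ 1
     else if i = 2 then D * A * x $ 2
     else if i = 3 then P * x $ 1 + D * A^2 * x $ 3
     else if i = 4 then P * A * x $ 2 + D * A^3 * x $ 4
     else if i = 5 then P * A^2 * x $ 3 + D * A^4 * x $ 5
     else D * B * b11 * x $ 2 - (D * b12 + P * b14) * A * B * x $ 3 + P * A^3 * x $ 4
       - D * A^3 * B * b14 * x $ 5 + D * A^5 * x $ 6)"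

lemma basis_change_component:
  "basis_change b11 b12 b14 A B D P x $ 0 = A * x $ 0"
  "basis_change b11 b12 b14 A B D P x $ 1 = B * x $ 0 + D * x $ 1"
  "basis_change b11 b12 b14 A B D P x $ 2 = D * A * x $ 2"
  "basis_change b11 b12 b14 A B D P x $ 3 = P * x $ 1 + D * A^2 * x $ 3"
  "basis_change b11 b12 b14 A B D P x $ 4 = P * A * x $ 2 + D * A^3 * x $ 4"
  "basis_change b11 b12 b14 A B D P x $ 5 = P * A^2 * x $ 3 + D * A^4 * x $ 5"
  "basis_change b11 b12 b14 A B D P x $ 6 =
     D * B * b11 * x $ 2 - (D * b12 + P * b14) * A * B * x $ 3 + P * A^3 * x $ 4
       - D * A^3 * B * b14 * x $ 5 + D * A^5 * x $ 6"
  by (simp_all add: basis_change_def)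

lemma linear_basis_change:
  "Vector_Spaces.linear (*s) (*s) (basis_change b11 b12 b14 A B D P)"
  by unfold_locales
    (simp_all add: vec_eq_iff forall_7 basis_change_component algebra_simps)

text \<open>The matrix is lower triangular with diagonal \<open>A, D, D A, ..., D A^5\<close>, so
  the kernel vanishes; finite dimension gives surjectivity.\<close>

lemma bij_basis_change:
  assumes "A \<noteq> 0" "D \<noteq> 0"
  shows "bij (basis_change b11 b12 b14 A B D P)"
proof -
  have "inj (basis_change b11 b12 b14 A B D P)"
    unfolding vec.linear_inj_iff_eq_0[OF linear_basis_change]
    using assms by (auto simp: vec_eq_iff forall_7 basis_change_component)
  then show ?thesis
    using vec.linear_injective_imp_surjective[OF linear_basis_change] by (auto simp: bij_def)
qed

text \<open>The extra entries in coordinate 6 are the \<open>e 6\<close> terms arising in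
  \<open>[e\<^sub>i', e\<^sub>0']\<close>, so these brackets match by construction. The five
  assumptions compare \<open>e 6\<close> coefficients in the brackets \<open>(0,0)\<close>,
  \<open>(0,1)\<close>, \<open>(1,1)\<close>, \<open>(1,2)\<close>, \<open>(1,4)\<close> of the new
  basis.\<close>

lemma basis_change_bracket:
  fixes b00 b01 b11 b12 b14 c00 c01 c11 c12 c14 A B D P :: complex
  assumes c00: "D * A^5 * c00 = b00 * A^2 + b01 * A * B + b11 * B^2"
    and c01: "D * A^5 * c01 = D * (b01 * A + 2 * b11 * B)"
    and c11: "D * A^5 * c11 = b11 * D^2"
    and c12: "D * A^5 * c12 = D * A * (D * b12 + 2 * P * b14)"
    and c14: "D * A^5 * c14 = D^2 * A^3 * b14"
  shows "basis_change b11 b12 b14 A B D P (L c00 c01 c11 c12 c14 x y) =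
     L b00 b01 b11 b12 b14 (basis_change b11 b12 b14 A B D P x) (basis_change b11 b12 b14 A B D P y)"
proof -
  \<comment> \<open>Shaped like coordinate 6 of \<open>L\<close>, so that rewriting eliminates every
    \<open>c\<close> and leaves a polynomial identity.\<close>
  have top: "D * A^5 * (z + c00 * x $ 0 * y $ 0 + c01 * x $ 0 * y $ 1 + c11 * x $ 1 * y $ 1
        + c12 * s + c14 * t) =
      D * A^5 * z + (b00 * A^2 + b01 * A * B + b11 * B^2) * (x $ 0 * y $ 0)
      + D * (b01 * A + 2 * b11 * B) * (x $ 0 * y $ 1) + b11 * D^2 * (x $ 1 * y $ 1)
      + D * A * (D * b12 + 2 * P * b14) * s + D^2 * A^3 * b14 * t" for z s t
    unfolding assms[symmetric] by (simp add: ring_distribs mult.assoc)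
  have A_powers: "A ^ 4 = A * (A * (A * A))" "A ^ 5 = A * (A * (A * (A * A)))"
    by (simp_all add: power_numeral_reduce)
  show ?thesis
    unfolding vec_eq_iff forall_7 basis_change_component L_component top
    by (intro conjI)
      (simp_all add: algebra_simps power2_eq_square power3_eq_cube A_powers)
qed

text \<open>The same conditions with common factors cancelled, ready for solving for
  \<open>A\<close>, \<open>B\<close>, \<open>D\<close>, \<open>P\<close> in each case.\<close>

lemma L_iso:
  fixes b00 b01 b11 b12 b14 c00 c01 c11 c12 c14 A B D P :: complex
  assumes "A \<noteq> 0" "D \<noteq> 0"
    and c00: "D * A^5 * c00 = b00 * A^2 + b01 * A * B + b11 * B^2"
    and c01: "A^5 * c01 = b01 * A + 2 * b11 * B"
    and c11: "A^5 * c11 = b11 * D"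
    and c12: "A^4 * c12 = D * b12 + 2 * P * b14"
    and c14: "A^2 * c14 = D * b14"
  shows "L b00 b01 b11 b12 b14 \<cong>\<^sub>L L c00 c01 c11 c12 c14"
proof -
  have "leibniz_isomorphism (*s) (L c00 c01 c11 c12 c14) (*s) (L b00 b01 b11 b12 b14)
      (basis_change b11 b12 b14 A B D P)"
  proof (intro leibniz_isomorphism.intro leibniz_isomorphism_axioms.intro leibniz_algebra_L
      linear_basis_change bij_basis_change basis_change_bracket \<open>A \<noteq> 0\<close> \<open>D \<noteq> 0\<close> c00)
    show "D * A^5 * c01 = D * (b01 * A + 2 * b11 * B)"
      by (simp only: mult.assoc c01)
    show "D * A^5 * c11 = b11 * D^2"
      by (simp only: mult.assoc c11) (simp add: power2_eq_square)
    have A5: "A^5 = A * A^4"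
      using power_Suc[of A 4] by simp
    show "D * A^5 * c12 = D * A * (D * b12 + 2 * P * b14)"
      by (simp only: A5 mult.assoc c12)
    have A5: "A^5 = A^3 * A^2"
      using power_add[of A 3 2] by simp
    show "D * A^5 * c14 = D^2 * A^3 * b14"
      by (simp only: A5 mult.assoc c14) (simp add: power2_eq_square)
  qed
  then show ?thesis
    by (rule leibniz_isomorphic_sym[OF leibniz_isomorphic_def[THEN iffD2], OF exI])
qed

text \<open>An exponential is a root that is visibly nonzero.\<close>

lemma ex_nonzero_complex_root:
  fixes c :: complex
  assumes "n > 0" "c \<noteq> 0"
  obtains A where "A \<noteq> 0" "A ^ n = c"
proof
  show "exp (Ln c / of_nat n) ^ n = c"
    unfolding exp_of_nat_mult[symmetric] using assms by simp
qed simp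

theorem proposition3p11:
  fixes b00 b01 b11 b12 b14 \<Delta> :: complex
  assumes \<Delta>: "\<Delta> = b01\<^sup>2 - 4 * b00 * b11"
  shows
    "(b11 \<noteq> 0 \<and> b14 = 0 \<and> b12 = 0 \<and> \<Delta> \<noteq> 0
        \<longrightarrow> L b00 b01 b11 b12 b14 \<cong>\<^sub>L L 1 0 1 0 0) \<and>
     (b11 \<noteq> 0 \<and> b14 = 0 \<and> b12 = 0 \<and> \<Delta> = 0
        \<longrightarrow> L b00 b01 b11 b12 b14 \<cong>\<^sub>L L 0 0 1 0 0) \<and>
     (b11 = 0 \<and> b01 \<noteq> 0 \<and> b14 \<noteq> 0
        \<longrightarrow> L b00 b01 b11 b12 b14 \<cong>\<^sub>L L 0 1 0 0 1) \<and>
     (b11 = 0 \<and> b01 \<noteq> 0 \<and> b14 = 0 \<and> b12 \<noteq> 0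
        \<longrightarrow> L b00 b01 b11 b12 b14 \<cong>\<^sub>L L 0 1 0 1 0) \<and>
     (b11 = 0 \<and> b01 \<noteq> 0 \<and> b14 = 0 \<and> b12 = 0
        \<longrightarrow> L b00 b01 b11 b12 b14 \<cong>\<^sub>L L 0 1 0 0 0) \<and>
     (b11 = 0 \<and> b01 = 0 \<and> b00 \<noteq> 0 \<and> b14 \<noteq> 0
        \<longrightarrow> L b00 b01 b11 b12 b14 \<cong>\<^sub>L L 1 0 0 0 1) \<and>
     (b11 = 0 \<and> b01 = 0 \<and> b00 \<noteq> 0 \<and> b14 = 0 \<and> b12 \<noteq> 0
        \<longrightarrow> L b00 b01 b11 b12 b14 \<cong>\<^sub>L L 1 0 0 1 0) \<and>
     (b11 = 0 \<and> b01 = 0 \<and> b00 \<noteq> 0 \<and> b14 = 0 \<and> b12 = 0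
        \<longrightarrow> L b00 b01 b11 b12 b14 \<cong>\<^sub>L L 1 0 0 0 0) \<and>
     (b11 = 0 \<and> b01 = 0 \<and> b00 = 0 \<and> b14 \<noteq> 0
        \<longrightarrow> L b00 b01 b11 b12 b14 \<cong>\<^sub>L L 0 0 0 0 1) \<and>
     (b11 = 0 \<and> b01 = 0 \<and> b00 = 0 \<and> b14 = 0 \<and> b12 \<noteq> 0
        \<longrightarrow> L b00 b01 b11 b12 b14 \<cong>\<^sub>L L 0 0 0 1 0) \<and>
     (b11 = 0 \<and> b01 = 0 \<and> b00 = 0 \<and> b14 = 0 \<and> b12 = 0
        \<longrightarrow> L b00 b01 b11 b12 b14 \<cong>\<^sub>L L 0 0 0 0 0)"
proof (intro conjI impI; elim conjE)
  assume h: "b11 \<noteq> 0" "b14 = 0" "b12 = 0" "\<Delta> \<noteq> 0"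
  \<comment> \<open>\<open>c11 = 1\<close> forces \<open>D = A^5 / b11\<close>. Completing the
    square leaves \<open>- \<Delta> A^2 / (4 b11)\<close>, which must equal
    \<open>A^10 / b11\<close>.\<close>
  obtain A where A: "A \<noteq> 0" "A ^ 8 = - \<Delta> / 4"
    using ex_nonzero_complex_root[of 8 "- \<Delta> / 4"] h by auto
  have A8: "A ^ 8 = b00 * b11 - b01\<^sup>2 / 4"
    using A \<Delta> by (simp add: field_simps)
  show "L b00 b01 b11 b12 b14 \<cong>\<^sub>L L 1 0 1 0 0"
  proof (rule L_iso[where A = A and B = "- b01 * A / (2 * b11)" and D = "A ^ 5 / b11" and P = 0])
    have "A ^ 5 / b11 * A ^ 5 * 1 = A ^ 8 * A\<^sup>2 / b11"
      by (simp flip: power_add)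
    also have "\<dots> = b00 * A\<^sup>2 + b01 * A * (- b01 * A / (2 * b11)) + b11 * (- b01 * A / (2 * b11))\<^sup>2"
      unfolding A8 using h by (simp add: field_simps power2_eq_square)
    finally show "A ^ 5 / b11 * A ^ 5 * 1 = \<dots>" .
  qed (use h A in simp_all)
next
  assume h: "b11 \<noteq> 0" "b14 = 0" "b12 = 0" "\<Delta> = 0"
  show "L b00 b01 b11 b12 b14 \<cong>\<^sub>L L 0 0 1 0 0"
    by (rule L_iso[where A = 1 and B = "- b01 / (2 * b11)" and D = "1 / b11" and P = 0])
      (use h \<Delta> in \<open>simp_all add: field_simps power2_eq_square\<close>)
next
  assume h: "b11 = 0" "b01 \<noteq> 0" "b14 \<noteq> 0"
  \<comment> \<open>\<open>c01 = 1\<close> forces \<open>A^4 = b01\<close>; then \<open>B\<close>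
    cancels \<open>b00\<close>, \<open>D\<close> gives \<open>c14 = 1\<close> and \<open>P\<close>
    cancels \<open>b12\<close>.\<close>
  obtain A where A: "A \<noteq> 0" "A ^ 4 = b01"
    using ex_nonzero_complex_root[of 4 b01] h by auto
  then have A5: "A ^ 5 = b01 * A"
    by (simp add: power_numeral_reduce)
  show "L b00 b01 b11 b12 b14 \<cong>\<^sub>L L 0 1 0 0 1"
    by (rule L_iso[where A = A and B = "- b00 * A / b01" and D = "A\<^sup>2 / b14"
          and P = "- (A\<^sup>2 / b14) * b12 / (2 * b14)"])
      (use h \<open>A \<noteq> 0\<close> A5 in \<open>simp_all add: power2_eq_square\<close>)
next
  assume h: "b11 = 0" "b01 \<noteq> 0" "b14 = 0" "b12 \<noteq> 0"
  obtain A where A: "A \<noteq> 0" "A ^ 4 = b01"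
    using ex_nonzero_complex_root[of 4 b01] h by auto
  then have A5: "A ^ 5 = b01 * A"
    by (simp add: power_numeral_reduce)
  show "L b00 b01 b11 b12 b14 \<cong>\<^sub>L L 0 1 0 1 0"
    by (rule L_iso[where A = A and B = "- b00 * A / b01" and D = "A ^ 4 / b12" and P = 0])
      (use h \<open>A \<noteq> 0\<close> A5 in \<open>simp_all add: power2_eq_square\<close>)
next
  assume h: "b11 = 0" "b01 \<noteq> 0" "b14 = 0" "b12 = 0"
  obtain A where A: "A \<noteq> 0" "A ^ 4 = b01"
    using ex_nonzero_complex_root[of 4 b01] h by auto
  then have A5: "A ^ 5 = b01 * A"
    by (simp add: power_numeral_reduce)
  show "L b00 b01 b11 b12 b14 \<cong>\<^sub>L L 0 1 0 0 0"
    by (rule L_iso[where A = A and B = "- b00 * A / b01" and D = 1 and P = 0])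
      (use h \<open>A \<noteq> 0\<close> A5 in \<open>simp_all add: power2_eq_square\<close>)
next
  assume h: "b11 = 0" "b01 = 0" "b00 \<noteq> 0" "b14 \<noteq> 0"
  \<comment> \<open>\<open>c14 = 1\<close> forces \<open>D = A^2 / b14\<close>, and
    \<open>c00 = 1\<close> then reads \<open>A^7 / b14 = b00 A^2\<close>.\<close>
  obtain A where A: "A \<noteq> 0" "A ^ 5 = b00 * b14"
    using ex_nonzero_complex_root[of 5 "b00 * b14"] h by auto
  show "L b00 b01 b11 b12 b14 \<cong>\<^sub>L L 1 0 0 0 1"
    by (rule L_iso[where A = A and B = 0 and D = "A\<^sup>2 / b14" and P = "- (A\<^sup>2 / b14) * b12 / (2 * b14)"])
      (use h A in \<open>simp_all add: power2_eq_square\<close>)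
next
  assume h: "b11 = 0" "b01 = 0" "b00 \<noteq> 0" "b14 = 0" "b12 \<noteq> 0"
  \<comment> \<open>Now \<open>c12 = 1\<close> forces \<open>D = A^4 / b12\<close>, so
    \<open>c00 = 1\<close> reads \<open>A^9 / b12 = b00 A^2\<close>.\<close>
  obtain A where A: "A \<noteq> 0" "A ^ 7 = b00 * b12"
    using ex_nonzero_complex_root[of 7 "b00 * b12"] h by auto
  show "L b00 b01 b11 b12 b14 \<cong>\<^sub>L L 1 0 0 1 0"
  proof (rule L_iso[where A = A and B = 0 and D = "A ^ 4 / b12" and P = 0])
    have "A ^ 4 / b12 * A ^ 5 * 1 = A ^ 7 * A\<^sup>2 / b12"
      by (simp flip: power_add)
    then show "A ^ 4 / b12 * A ^ 5 * 1 = b00 * A\<^sup>2 + b01 * A * 0 + b11 * 0\<^sup>2"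
      using h A by simp
  qed (use h A in simp_all)
next
  assume h: "b11 = 0" "b01 = 0" "b00 \<noteq> 0" "b14 = 0" "b12 = 0"
  show "L b00 b01 b11 b12 b14 \<cong>\<^sub>L L 1 0 0 0 0"
    by (rule L_iso[where A = 1 and B = 0 and D = b00 and P = 0]) (use h in simp_all)
next
  assume h: "b11 = 0" "b01 = 0" "b00 = 0" "b14 \<noteq> 0"
  show "L b00 b01 b11 b12 b14 \<cong>\<^sub>L L 0 0 0 0 1"
    by (rule L_iso[where A = 1 and B = 0 and D = "1 / b14" and P = "- (1 / b14) * b12 / (2 * b14)"])
      (use h in \<open>simp_all add: power2_eq_square\<close>)
next
  assume h: "b11 = 0" "b01 = 0" "b00 = 0" "b14 = 0" "b12 \<noteq> 0"
  show "L b00 b01 b11 b12 b14 \<cong>\<^sub>L L 0 0 0 1 0"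
    by (rule L_iso[where A = 1 and B = 0 and D = "1 / b12" and P = 0])
      (use h in \<open>simp_all add: power2_eq_square\<close>)
next
  assume h: "b11 = 0" "b01 = 0" "b00 = 0" "b14 = 0" "b12 = 0"
  show "L b00 b01 b11 b12 b14 \<cong>\<^sub>L L 0 0 0 0 0"
    by (rule L_iso[where A = 1 and B = 0 and D = 1 and P = 0]) (use h in simp_all)
qed

end
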